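(* Let $\mathit{Exp}$ be the set of conditional expressions over a set $A$ of symbols, and let $\prec$ be the recursion relation on $\mathit{Exp}$ of the normalization function $norm$, as defined in the context. Then $\prec$ is well-founded; that is, for every predicate $P$ on $\mathit{Exp}$, $$\Bigl(\forall x.\,\bigl(\forall x'.\,x'\prec x\Rightarrow P(x')\bigr)\Rightarrow P(x)\Bigr)\;\Longrightarrow\;\forall x.\,P(x),$$ where $x,x'$ range over $\mathit{Exp}$.
   Context: Fix a set $A$ of symbols. The set $\mathit{Exp}$ of conditional expressions is the inductive type freely generated by the constructors $At(a)$ for $a\in A$ and $\mathit{If}(x,y,z)$ for $x,y,z\in\mathit{Exp}$. The normalization function $norm$ is given by the recursion equations $$norm(At(a))=At(a),$$ $$norm(\mathit{If}(At(a),y,z))=\mathit{If}(At(a),norm(y),norm(z)),$$ $$norm(\mathit{If}(\mathit{If}(u,v,w),y,z))=norm(\mathit{If}(u,\mathit{If}(v,y,z),\mathit{If}(w,y,z))).$$ Its recursion relation $\prec$ on $\mathit{Exp}$ ($x'\prec x$ meaning that evaluating $norm(x)$ makes the recursive call $norm(x')$) is defined by cases on the right-hand argument: $$x\prec At(a)\iff \textit{false},$$ $$x\prec \mathit{If}(At(a),y,z)\iff x=y\lor x=z,$$ $$x\prec \mathit{If}(\mathit{If}(u,v,w),y,z)\iff x=\mathit{If}(u,\mathit{If}(v,y,z),\mathit{If}(w,y,z)).$$ A relation is called well-founded if its rule of well-founded induction is sound for every predicate $P$. *)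

theory Defs
  imports Main
begin

datatype 'a exp = At 'a | IF "'a exp" "'a exp" "'a exp"

text \<open>
  Termination of \<open>norm\<close> is deliberately not proved here: it amounts to the well-foundedness
  of its recursion relation.
\<close>

function norm :: "'a exp \<Rightarrow> 'a exp" where
  "norm (At a) = At a"
| "norm (IF (At a) y z) = IF (At a) (norm y) (norm z)"
| "norm (IF (IF u v w) y z) = norm (IF u (IF v y z) (IF w y z))"
  by pat_completeness auto

fun prec :: "'a exp \<Rightarrow> 'a exp \<Rightarrow> bool" (infix "\<prec>" 50) where
  "x \<prec> At a \<longleftrightarrow> False"
| "x \<prec> IF (At a) y z \<longleftrightarrow> x = y \<or> x = z"
| "x \<prec> IF (IF u v w) y z \<longleftrightarrow> x = IF u (IF v y z) (IF w y z)"

text \<open>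
  \<open>norm_rel\<close> is the recursive-call relation extracted from the equations of \<open>norm\<close>.
\<close>

lemma prec_eq_norm_rel: "(\<prec>) = norm_rel"
proof (intro ext iffI)
  fix x' x :: "'a exp"
  show "norm_rel x' x" if "x' \<prec> x"
    using that by (cases "(x', x)" rule: prec.cases) (auto intro: norm_rel.intros)
  show "x' \<prec> x" if "norm_rel x' x"
    using that by cases auto
qed

end

theory Submission
  imports Defs
begin

text \<open>
  Every expression is accessible. For conditionals, structural induction on the test suffices once
  the branches range over arbitrary accessible expressions, since the recursive call on
  \<open>IF (IF u v w) y z\<close> builds new branches whose tests are \<open>v\<close> and \<open>w\<close>. No measure function
  is needed.
\<close>

lemma accp_prec_IF:
  assumes "Wellfounded.accp (\<prec>) y" and "Wellfounded.accp (\<prec>) z"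
  shows "Wellfounded.accp (\<prec>) (IF x y z)"
  using assms
proof (induction x arbitrary: y z)
  case (At a)
  \<comment> \<open>The only predecessors are \<open>y\<close> and \<open>z\<close>, accessible by
    assumption.\<close>
  show ?case
    by (rule accp.accI) (use At in auto)
next
  case (IF u v w)
  \<comment> \<open>The hypotheses for \<open>v\<close> and \<open>w\<close> make the two new
    branches accessible; the one for \<open>u\<close> is then applied at these branches instead of
    \<open>y\<close> and \<open>z\<close>.\<close>
  have "Wellfounded.accp (\<prec>) (IF u (IF v y z) (IF w y z))"
    by (rule IF.IH(1)[OF IF.IH(2)[OF IF.prems] IF.IH(3)[OF IF.prems]])
  then show ?case
    \<comment> \<open>The expression just treated is the sole predecessor of the goal.\<close>
    by (metis accp.accI prec.simps(3))
qed

lemma accp_prec: "Wellfounded.accp (\<prec>) x"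
proof (induction x)
  case (At a)
  show ?case
    by (rule accp.accI) simp
next
  case (IF x y z)
  then show ?case
    by (simp add: accp_prec_IF)
qed

theorem mainTheorem1:
  "wfp ((\<prec>) :: 'a exp \<Rightarrow> 'a exp \<Rightarrow> bool) \<and>
   (\<forall>P :: 'a exp \<Rightarrow> bool.
      (\<forall>x. (\<forall>x'. x' \<prec> x \<longrightarrow> P x') \<longrightarrow> P x) \<longrightarrow> (\<forall>x. P x))"
proof
  show wf: "wfp ((\<prec>) :: 'a exp \<Rightarrow> 'a exp \<Rightarrow> bool)"
    \<comment> \<open>Well-foundedness amounts to accessibility of every element.\<close>
    by (rule accp_wfpI) (rule allI, rule accp_prec)
  show "\<forall>P :: 'a exp \<Rightarrow> bool.
      (\<forall>x. (\<forall>x'. x' \<prec> x \<longrightarrow> P x') \<longrightarrow> P x) \<longrightarrow> (\<forall>x. P x)"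
  proof (intro allI impI)
    fix P :: "'a exp \<Rightarrow> bool" and x
    assume step: "\<forall>x. (\<forall>x'. x' \<prec> x \<longrightarrow> P x') \<longrightarrow> P x"
    from wf show "P x"
    proof (induction x rule: wfp_induct_rule)
      case (less x)
      with step show ?case
        by simp
    qed
  qed
qed

end
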